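(* Let $L$ be a $4$-dimensional solvable right Leibniz algebra over $\mathbb C$ with $2$-dimensional nilradical. Then $L$ is dextral symmetric if and only if it is isomorphic to the algebra $\mathscr R_1$ with basis $\{x,y,z,w\}$ and non-zero brackets of basis elements $$[x,z]=x,\qquad [y,w]=y.$$
   Context: A right Leibniz algebra over a field $F$ is an $F$-vector space $L$ with a bilinear bracket $[\,,]:L\times L\to L$ satisfying $[a,[b,c]]=[[a,b],c]-[[a,c],b]$ for all $a,b,c\in L$. $L$ is solvable if $L^{[k]}=0$ for some $k\in\mathbb N$, where $L^{[1]}=L$, $L^{[n+1]}=[L^{[n]},L^{[n]}]$ (span of brackets). A Leibniz algebra $N$ is nilpotent (equivalently, right nilpotent) if $N^{<k>}=0$ for some $k$, where $N^{<1>}=N$, $N^{<n+1>}=[N^{<n>},N]$. The nilradical of $L$ is its maximal nilpotent (two-sided) ideal. $L$ is dextral symmetric if for all $a,b,c\in L$, $[a,[b,c]]=0$ implies $[b,[a,c]]=0$. Brackets of basis elements not listed are zero. *)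

theory Defs
  imports "HOL-Analysis.Analysis"
begin

text \<open>The algebra is carried by a whole type, as is usual for the locale \<open>vector_space\<close>.\<close>

locale right_leibniz_algebra = vector_space scale
  for scale :: "'k::field \<Rightarrow> 'a::ab_group_add \<Rightarrow> 'a" +
  fixes bracket :: "'a \<Rightarrow> 'a \<Rightarrow> 'a"
  assumes linear_left: "Vector_Spaces.linear scale scale (\<lambda>a. bracket a b)"
    and linear_right: "Vector_Spaces.linear scale scale (\<lambda>b. bracket a b)"
    and leibniz: "bracket a (bracket b c) = bracket (bracket a b) c - bracket (bracket a c) b"
begin

definition bracket_span :: "'a set \<Rightarrow> 'a set \<Rightarrow> 'a set" where
  "bracket_span A B = span {bracket a b | a b. a \<in> A \<and> b \<in> B}"

text \<open>Both series are indexed from 0: \<open>derived_series n\<close> is $L^{[n+1]}$ and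
  \<open>lower_central_series N n\<close> is $N^{\langle n+1\rangle}$.\<close>

primrec derived_series :: "nat \<Rightarrow> 'a set" where
  "derived_series 0 = UNIV"
| "derived_series (Suc n) = bracket_span (derived_series n) (derived_series n)"

definition solvable :: bool where
  "solvable \<longleftrightarrow> (\<exists>n. derived_series n = {0})"

primrec lower_central_series :: "'a set \<Rightarrow> nat \<Rightarrow> 'a set" where
  "lower_central_series N 0 = N"
| "lower_central_series N (Suc n) = bracket_span (lower_central_series N n) N"

definition nilpotent :: "'a set \<Rightarrow> bool" where
  "nilpotent N \<longleftrightarrow> (\<exists>n. lower_central_series N n = {0})"

definition two_sided_ideal :: "'a set \<Rightarrow> bool" where
  "two_sided_ideal I \<longleftrightarrow> subspace I \<and> (\<forall>a\<in>I. \<forall>l. bracket a l \<in> I \<and> bracket l a \<in> I)"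

text \<open>Maximality is with respect to inclusion. A sum of two nilpotent ideals is nilpotent, so
  there is at most one maximal nilpotent ideal.\<close>

definition is_nilradical :: "'a set \<Rightarrow> bool" where
  "is_nilradical N \<longleftrightarrow> two_sided_ideal N \<and> nilpotent N \<and>
     (\<forall>I. two_sided_ideal I \<and> nilpotent I \<and> N \<subseteq> I \<longrightarrow> I = N)"

definition dextral_symmetric :: bool where
  "dextral_symmetric \<longleftrightarrow>
     (\<forall>a b c. bracket a (bracket b c) = 0 \<longrightarrow> bracket b (bracket a c) = 0)"

end

definition leibniz_isomorphic ::
  "('k::field \<Rightarrow> 'a::ab_group_add \<Rightarrow> 'a) \<Rightarrow> ('a \<Rightarrow> 'a \<Rightarrow> 'a) \<Rightarrow>
   ('k \<Rightarrow> 'b::ab_group_add \<Rightarrow> 'b) \<Rightarrow> ('b \<Rightarrow> 'b \<Rightarrow> 'b) \<Rightarrow> bool" where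
  "leibniz_isomorphic scale1 bracket1 scale2 bracket2 \<longleftrightarrow>
     (\<exists>f. Vector_Spaces.linear scale1 scale2 f \<and> bij f \<and>
          (\<forall>a b. f (bracket1 a b) = bracket2 (f a) (f b)))"

text \<open>The algebra $\mathscr R_1$ lives on the coordinate space, with
  $x, y, z, w$ the coordinate vectors \<open>axis 1 1\<close>, \<open>axis 2 1\<close>, \<open>axis 3 1\<close>, \<open>axis 4 1\<close>.\<close>

definition R1_basis_bracket :: "4 \<Rightarrow> 4 \<Rightarrow> complex ^ 4" where
  "R1_basis_bracket i j =
     (if i = 1 \<and> j = 3 then axis 1 1 else if i = 2 \<and> j = 4 then axis 2 1 else 0)"

definition R1_bracket :: "complex ^ 4 \<Rightarrow> complex ^ 4 \<Rightarrow> complex ^ 4" where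
  "R1_bracket a b = (\<Sum>i\<in>UNIV. \<Sum>j\<in>UNIV. (a $ i * b $ j) *s R1_basis_bracket i j)"

lemma R1_bracket_coordinates:
  "R1_bracket a b $ 1 = a $ 1 * b $ 3"
  "R1_bracket a b $ 2 = a $ 2 * b $ 4"
  "R1_bracket a b $ 3 = 0"
  "R1_bracket a b $ 4 = 0"
  by (simp_all add: R1_bracket_def R1_basis_bracket_def sum_4 axis_def)

lemma R1_bracket_basis:
  "R1_bracket (axis i 1) (axis j 1) = R1_basis_bracket i j"
proof -
  have "i = 1 \<or> i = 2 \<or> i = 3 \<or> i = 4" "j = 1 \<or> j = 2 \<or> j = 3 \<or> j = 4"
    by (rule exhaust_4)+
  then show ?thesis
    by (auto simp: vec_eq_iff forall_4 R1_bracket_coordinates R1_basis_bracket_def axis_def)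
qed

lemma right_leibniz_algebra_R1: "right_leibniz_algebra (*s) R1_bracket"
  by unfold_locales
    (simp_all add: vec_eq_iff forall_4 R1_bracket_coordinates algebra_simps)

end

theory Submission imports Defs begin

text \<open>Write \<open>T(a,b,c) = [a,[b,c]]\<close>. Since \<open>[a,[c,c]] = 0\<close>, dextral symmetry gives
  \<open>[c,[a,c]] = 0\<close>, and so it makes \<open>T\<close> alternating. It follows that \<open>[a,[b,[c,d]]] = 0\<close>, so
  \<open>[L,L]\<close> is an abelian ideal and lies in the nilradical \<open>N\<close>. By maximality no \<open>a \<notin> N\<close> acts
  nilpotently on \<open>N\<close> from the right. In dimension \<open>4 = 2 + 2\<close> this forces \<open>N\<close> to be abelian and
  \<open>L/N\<close> to act on \<open>N\<close> as the algebra of all diagonal matrices in a suitable basis \<open>x, y\<close>: an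
  operator of trace zero squares to a nonzero scalar, and its eigenvectors diagonalise the other
  operators. Alternation of \<open>T\<close> then gives \<open>[L,N] = 0\<close>, and the elements \<open>z, w\<close> acting as the
  diagonal idempotents can be corrected modulo \<open>N\<close> so that they annihilate each other and
  themselves. Conversely \<open>[a,[b,c]] = 0\<close> identically in \<open>R_1\<close>.\<close>

section \<open>Lower central series and sums of nilpotent ideals\<close>

context right_leibniz_algebra
begin

lemma bracket_add_left: "bracket (a + b) c = bracket a c + bracket b c"
  and bracket_scale_left: "bracket (scale r a) c = scale r (bracket a c)"
  using linear_left[of c] by (simp_all add: Vector_Spaces.linear_iff)

lemma bracket_add_right: "bracket c (a + b) = bracket c a + bracket c b"
  and bracket_scale_right: "bracket c (scale r a) = scale r (bracket c a)"
  using linear_right[of c] by (simp_all add: Vector_Spaces.linear_iff)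

lemma bracket_zero_left [simp]: "bracket 0 a = 0"
  using bracket_scale_left[of 0 0 a] by simp

lemma bracket_zero_right [simp]: "bracket a 0 = 0"
  using bracket_scale_right[of a 0 0] by simp

lemma bracket_minus_left: "bracket (- a) b = - bracket a b"
  using bracket_add_left[of a "- a" b] by (simp add: eq_neg_iff_add_eq_0 add.commute)

lemma bracket_minus_right: "bracket a (- b) = - bracket a b"
  using bracket_add_right[of a b "- b"] by (simp add: eq_neg_iff_add_eq_0 add.commute)

lemma bracket_diff_left: "bracket (a - b) c = bracket a c - bracket b c"
  using bracket_add_left[of a "- b" c] by (simp add: bracket_minus_left)

lemma bracket_diff_right: "bracket a (b - c) = bracket a b - bracket a c"
  using bracket_add_right[of a b "- c"] by (simp add: bracket_minus_right)

lemmas bracket_linear = bracket_add_left bracket_add_right bracket_diff_left bracket_diff_right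
  bracket_minus_left bracket_minus_right bracket_scale_left bracket_scale_right

lemma right_derivation: "bracket (bracket a b) c = bracket a (bracket b c) + bracket (bracket a c) b"
  using leibniz[of a b c] by simp

lemma bracket_inner_square: "bracket a (bracket b b) = 0"
  using leibniz[of a b b] by simp

lemma bracket_inner_skew: "bracket a (bracket c b) = - bracket a (bracket b c)"
  using leibniz[of a b c] leibniz[of a c b] by simp

lemma bracket_span_memI: "a \<in> A \<Longrightarrow> b \<in> B \<Longrightarrow> bracket a b \<in> bracket_span A B"
  unfolding bracket_span_def by (rule span_base) blast

lemma subspace_bracket_span: "subspace (bracket_span A B)"
  unfolding bracket_span_def by (rule subspace_span)

lemma bracket_span_subset:
  assumes "subspace W" and "\<And>a b. a \<in> A \<Longrightarrow> b \<in> B \<Longrightarrow> bracket a b \<in> W"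
  shows "bracket_span A B \<subseteq> W"
  unfolding bracket_span_def using assms by (intro span_minimal) auto

lemma bracket_span_mono: "A \<subseteq> A' \<Longrightarrow> B \<subseteq> B' \<Longrightarrow> bracket_span A B \<subseteq> bracket_span A' B'"
  unfolding bracket_span_def by (rule span_mono) blast

lemma subspace_zero: "subspace {0}"
  by (simp add: subspace_def)

lemma subspace_right_preimage: "subspace W \<Longrightarrow> subspace {p. bracket p l \<in> W}"
  unfolding subspace_def by (auto simp: bracket_linear)

lemma subspace_left_preimage: "subspace W \<Longrightarrow> subspace {p. bracket l p \<in> W}"
  unfolding subspace_def by (auto simp: bracket_linear)

lemma lower_central_series_subspace:
  "subspace I \<Longrightarrow> subspace (lower_central_series I n)"
  by (cases n) (simp_all add: subspace_bracket_span)

text \<open>Right multiplication by \<open>l\<close> is a derivation: \<open>[[a,b],l]\<close>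
  splits into \<open>[a,[b,l]]\<close> and \<open>[[a,l],b]\<close>, and both summands stay in the
  same term of the series.\<close>

lemma lower_central_series_right_ideal:
  assumes "two_sided_ideal I" "p \<in> lower_central_series I n"
  shows "bracket p l \<in> lower_central_series I n"
  using assms(2)
proof (induction n arbitrary: p)
  case 0
  then show ?case using assms(1) by (auto simp: two_sided_ideal_def)
next
  case (Suc n)
  have "bracket_span (lower_central_series I n) I
      \<subseteq> {p. bracket p l \<in> lower_central_series I (Suc n)}"
  proof (rule bracket_span_subset)
    fix a b assume ab: "a \<in> lower_central_series I n" "b \<in> I"
    have "bracket b l \<in> I" using assms(1) ab by (auto simp: two_sided_ideal_def)
    then show "bracket a b \<in> {p. bracket p l \<in> lower_central_series I (Suc n)}"
      using ab Suc.IH[OF ab(1)]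
      by (simp add: right_derivation[of a b l] bracket_span_memI subspace_add subspace_bracket_span)
  qed (rule subspace_right_preimage, simp add: subspace_bracket_span)
  then show ?case using Suc.prems by auto
qed

lemma lower_central_series_decreasing:
  assumes "two_sided_ideal I"
  shows "lower_central_series I (Suc n) \<subseteq> lower_central_series I n"
  unfolding lower_central_series.simps
  using assms lower_central_series_right_ideal[OF assms]
  by (intro bracket_span_subset lower_central_series_subspace) (auto simp: two_sided_ideal_def)

text \<open>A term that repeats once repeats forever, so nilpotency makes it zero. Hence the series
  drops strictly until it vanishes.\<close>

lemma lower_central_series_strict:
  assumes "nilpotent I" "two_sided_ideal I"
    and "lower_central_series I (Suc n) = lower_central_series I n"
  shows "lower_central_series I n = {0}"
proof -
  obtain k where k: "lower_central_series I k = {0}"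
    using assms(1) by (auto simp: nilpotent_def)
  have "lower_central_series I (n + m) = lower_central_series I n" for m
    by (induction m) (use assms(3) in simp_all)
  moreover have "lower_central_series I (k + m) \<subseteq> {0}" for m
    by (induction m)
      (use k lower_central_series_decreasing[OF assms(2)] in \<open>fastforce+\<close>)
  ultimately have "lower_central_series I n \<subseteq> {0}"
    by (metis add.commute)
  then show ?thesis
    using lower_central_series_subspace[of I n] assms(2) subspace_0
    unfolding two_sided_ideal_def by blast
qed

lemma two_sided_ideal_sum:
  assumes "two_sided_ideal I" "two_sided_ideal J"
  shows "two_sided_ideal (span (I \<union> J))"
proof -
  have "span (I \<union> J) \<subseteq> {p. bracket p l \<in> span (I \<union> J)}"
    and "span (I \<union> J) \<subseteq> {p. bracket l p \<in> span (I \<union> J)}" for l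
    using assms unfolding two_sided_ideal_def
    by (intro span_minimal subspace_right_preimage subspace_left_preimage subspace_span;
        auto intro: span_base)+
  then show ?thesis unfolding two_sided_ideal_def by auto
qed

text \<open>An iterated product in \<open>I + J\<close> expands into products of letters from
  \<open>I\<close> or \<open>J\<close>. A letter from \<open>I\<close> moves the product one step
  down the series of \<open>I\<close>, and any other letter keeps it in place because the terms are
  right ideals; likewise for \<open>J\<close>. A long product has many letters of one kind.\<close>

lemma nilpotent_sum:
  assumes I: "two_sided_ideal I" "nilpotent I" and J: "two_sided_ideal J" "nilpotent J"
  shows "nilpotent (span (I \<union> J))"
proof -
  define K where "K = span (I \<union> J)"
  \<comment> \<open>Shifted by one, so that a product of letters from \<open>I \<union> J\<close>, \<open>i\<close> of them from \<open>I\<close> and \<open>j\<close>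
    from \<open>J\<close>, lies in \<open>U I i \<inter> U J j\<close>.\<close>
  define U where "U I k = (case k of 0 \<Rightarrow> UNIV | Suc k \<Rightarrow> lower_central_series I k)" for I k
  have U_right: "bracket p l \<in> U I k" if "two_sided_ideal I" "p \<in> U I k" for I k p l
    using that lower_central_series_right_ideal by (auto simp: U_def split: nat.splits)
  have U_Suc: "bracket p l \<in> U I (Suc k)" if "two_sided_ideal I" "p \<in> U I k" "l \<in> I" for I k p l
    using that by (auto simp: U_def two_sided_ideal_def bracket_span_memI split: nat.splits)
  define G where "G n = span (\<Union>i\<le>n. U I i \<inter> U J (n - i))" for n
  have subspace_G: "subspace (G n)" for n by (simp add: G_def subspace_span)
  have G_I: "U I i \<inter> U J j \<subseteq> G n" if "i + j = n" for i j n
    unfolding G_def using that by (intro subsetI span_base) (auto intro!: bexI[of _ i])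
  \<comment> \<open>The term with index \<open>n\<close> is spanned by products of
    \<open>n + 1\<close> letters, hence \<open>Suc n\<close>.\<close>
  have series: "lower_central_series K n \<subseteq> G (Suc n)" for n
  proof (induction n)
    case 0
    have "I \<subseteq> G 1" using G_I[of 1 0 1] by (auto simp: U_def)
    moreover have "J \<subseteq> G 1" using G_I[of 0 1 1] by (auto simp: U_def)
    ultimately show ?case by (simp add: K_def span_minimal subspace_G)
  next
    case (Suc n)
    have G_bracket: "bracket p q \<in> G (Suc (Suc n))" if p: "p \<in> G (Suc n)" and q: "q \<in> K" for p q
    proof -
      have step: "bracket p q \<in> G (Suc (Suc n))"
        if "i \<le> Suc n" "p \<in> U I i" "p \<in> U J (Suc n - i)" for p i
      proof -
        have *: "bracket p u \<in> G (Suc (Suc n))" if "u \<in> I" for u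
          using U_Suc[OF I(1) \<open>p \<in> U I i\<close> that] U_right[OF J(1) \<open>p \<in> U J (Suc n - i)\<close>]
            G_I[of "Suc i" "Suc n - i"] \<open>i \<le> Suc n\<close> by auto
        have **: "bracket p u \<in> G (Suc (Suc n))" if "u \<in> J" for u
          using U_Suc[OF J(1) \<open>p \<in> U J (Suc n - i)\<close> that] U_right[OF I(1) \<open>p \<in> U I i\<close>]
            G_I[of i "Suc (Suc n - i)"] \<open>i \<le> Suc n\<close> by auto
        have "K \<subseteq> {q. bracket p q \<in> G (Suc (Suc n))}"
          unfolding K_def using * ** subspace_G
          by (intro span_minimal subspace_left_preimage) auto
        with q show ?thesis by auto
      qed
      have "G (Suc n) \<subseteq> {p. bracket p q \<in> G (Suc (Suc n))}"
        unfolding G_def[of "Suc n"]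
        using step subspace_G by (intro span_minimal subspace_right_preimage) auto
      with p show ?thesis by auto
    qed
    show ?case
      unfolding lower_central_series.simps
      using Suc.IH G_bracket by (intro bracket_span_subset subspace_G) blast
  qed
  obtain k l where kl: "lower_central_series I k = {0}" "lower_central_series J l = {0}"
    using I J by (auto simp: nilpotent_def)
  have small: "lower_central_series I (k + m) \<subseteq> {0}" "lower_central_series J (l + m) \<subseteq> {0}" for m
    by (induction m)
      (use kl lower_central_series_decreasing[OF I(1)] lower_central_series_decreasing[OF J(1)]
        in \<open>fastforce+\<close>)
  \<comment> \<open>Of \<open>k + l + 2\<close> letters, either more than \<open>k\<close> come from
    \<open>I\<close> or more than \<open>l\<close> come from \<open>J\<close>.\<close>
  have "U I i \<inter> U J (Suc (k + l + 1) - i) \<subseteq> {0}" if "i \<le> Suc (k + l + 1)" for i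
  proof (cases "i \<le> k")
    case True
    then have "Suc (k + l + 1) - i = Suc (l + (k - i + 1))" by simp
    then show ?thesis using small(2)[of "k - i + 1"] by (auto simp: U_def)
  next
    case False
    then have "i = Suc (k + (i - k - 1))" by simp
    then show ?thesis using small(1)[of "i - k - 1"] unfolding U_def by (metis nat.case(2) le_infI1)
  qed
  then have "G (Suc (k + l + 1)) \<subseteq> {0}"
    unfolding G_def by (intro span_minimal) (auto simp: subspace_def)
  then have "lower_central_series K (k + l + 1) \<subseteq> {0}"
    using series by blast
  moreover have "0 \<in> lower_central_series K (k + l + 1)"
    by (rule subspace_0, rule lower_central_series_subspace) (simp add: K_def subspace_span)
  ultimately show ?thesis unfolding nilpotent_def K_def by blast
qed

text \<open>Turns maximality under inclusion into being the largest: \<open>N + I\<close> is again a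
  nilpotent ideal, so it equals \<open>N\<close>.\<close>

lemma nilpotent_ideal_le_nilradical:
  assumes "is_nilradical N" "two_sided_ideal I" "nilpotent I"
  shows "I \<subseteq> N"
proof -
  have N: "two_sided_ideal N" "nilpotent N" using assms(1) by (auto simp: is_nilradical_def)
  have "N \<subseteq> span (N \<union> I)" by (meson Un_upper1 span_superset subset_trans)
  then have "span (N \<union> I) = N"
    using assms(1) two_sided_ideal_sum[OF N(1) assms(2)] nilpotent_sum[OF N assms(2,3)]
    unfolding is_nilradical_def by blast
  then show ?thesis using span_superset[of "N \<union> I"] by simp
qed

end

section \<open>The alternating triple product and the derived ideal\<close>

locale dextral_symmetric_algebra = right_leibniz_algebra scale bracket
  for scale :: "'k::field_char_0 \<Rightarrow> 'a::ab_group_add \<Rightarrow> 'a" and bracket +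
  assumes dextral: "dextral_symmetric"
begin

lemma bracket_self_outer: "bracket c (bracket a c) = 0"
  using dextral bracket_inner_square unfolding dextral_symmetric_def by blast

text \<open>Polarization of \<open>bracket_self_outer\<close>, evaluated at
  \<open>c + d\<close>.\<close>

lemma triple_skew_outer: "bracket d (bracket a c) = - bracket c (bracket a d)"
  using bracket_self_outer[of "c + d" a] bracket_self_outer[of c a] bracket_self_outer[of d a]
  by (simp add: bracket_linear eq_neg_iff_add_eq_0 add.commute)

lemma triple_rotate: "bracket b (bracket c a) = bracket a (bracket b c)"
  by (metis triple_skew_outer bracket_inner_skew minus_minus)

lemma triple_swap: "bracket b (bracket a c) = - bracket a (bracket b c)"
  by (metis triple_rotate bracket_inner_skew)

text \<open>The product \<open>q = [a,[b,[c,d]]]\<close> is alternating in all four arguments. Expanding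
  \<open>[a,[[b,c],d]] = -[a,[d,[b,c]]] = -q\<close> by the Leibniz identity gives \<open>2q\<close>.\<close>

lemma quadruple_zero: "bracket a (bracket b (bracket c d)) = 0"
proof -
  define q where "q = bracket a (bracket b (bracket c d))"
  have "bracket a (bracket d (bracket b c)) = q"
    unfolding q_def by (metis triple_rotate)
  then have "bracket a (bracket (bracket b c) d) = - q"
    by (metis bracket_inner_skew)
  moreover have "bracket a (bracket c (bracket b d)) = - q"
    unfolding q_def by (metis triple_swap bracket_minus_right)
  then have "bracket a (bracket (bracket b d) c) = q"
    by (metis bracket_inner_skew minus_minus)
  ultimately have "- q = q + q"
    by (simp add: right_derivation[of b c d] bracket_add_right q_def)
  then have "q + q + q = 0"
    by (metis add.left_inverse)
  moreover have "scale 3 q = q + q + q"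
    using scale_left_distrib[of 2 1 q] scale_left_distrib[of 1 1 q] by simp
  \<comment> \<open>In characteristic 0 the factor 3 can be cancelled.\<close>
  ultimately have "scale 3 q = 0" by simp
  then show ?thesis by (simp add: q_def)
qed

lemma derived_ideal: "two_sided_ideal (bracket_span UNIV UNIV)"
  by (simp add: two_sided_ideal_def subspace_bracket_span bracket_span_memI)

lemma derived_nilpotent: "nilpotent (bracket_span UNIV UNIV)"
proof -
  let ?D = "bracket_span UNIV UNIV"
  have "bracket a b = 0" if a: "a \<in> ?D" and b: "b \<in> ?D" for a b
  proof -
    \<comment> \<open>Rotation turns this product into \<open>[u,[v,[x,y]]]\<close>. Bilinearity
      then extends the vanishing to the spans, one argument at a time.\<close>
    have *: "bracket (bracket x y) (bracket u v) = 0" for x y u v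
      by (metis quadruple_zero triple_rotate)
    have "?D \<subseteq> {p. bracket p (bracket u v) \<in> {0}}" for u v
      using * by (intro bracket_span_subset subspace_right_preimage subspace_zero) auto
    with a have "?D \<subseteq> {q. bracket a q \<in> {0}}"
      by (intro bracket_span_subset subspace_left_preimage subspace_zero) auto
    with b show ?thesis by auto
  qed
  then have "bracket_span ?D ?D \<subseteq> {0}"
    by (intro bracket_span_subset) (auto intro: subspace_zero)
  then have "lower_central_series ?D 1 \<subseteq> {0}" by simp
  then have "lower_central_series ?D 1 = {0}"
    using subspace_0[OF subspace_bracket_span[of ?D ?D]] by auto
  then show ?thesis unfolding nilpotent_def by blast
qed

lemma bracket_in_nilradical: "is_nilradical N \<Longrightarrow> bracket a b \<in> N"
  using nilpotent_ideal_le_nilradical[OF _ derived_ideal derived_nilpotent]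
    bracket_span_memI[of a UNIV b UNIV] by blast

end

section \<open>Coordinates with respect to two vectors\<close>

context vector_space
begin

lemma span_pair_iff: "v \<in> span {x, y} \<longleftrightarrow> (\<exists>\<alpha> \<beta>. v = scale \<alpha> x + scale \<beta> y)"
  by (auto simp: span_breakdown_eq diff_eq_eq algebra_simps)

lemma independent_pair_zeroD:
  assumes "x \<noteq> 0" "y \<notin> span {x}" "scale \<alpha> x + scale \<beta> y = 0"
  shows "\<alpha> = 0" "\<beta> = 0"
proof -
  show "\<beta> = 0"
  proof (rule ccontr)
    assume "\<beta> \<noteq> 0"
    have "scale \<beta> y = scale (- \<alpha>) x" using assms(3) by (simp add: eq_neg_iff_add_eq_0 add.commute)
    then have "scale (1 / \<beta>) (scale \<beta> y) \<in> span {x}"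
      by (metis span_base span_scale singletonI)
    with \<open>\<beta> \<noteq> 0\<close> assms(2) show False by simp
  qed
  with assms show "\<alpha> = 0" by simp
qed

end

section \<open>Commutativity of a two-dimensional nilradical in dimension four\<close>

locale dextral_symmetric_nilradical_plane =
  dextral_symmetric_algebra scale bracket + finite_dimensional_vector_space scale Basis
  for scale :: "complex \<Rightarrow> 'a::ab_group_add \<Rightarrow> 'a" and bracket and Basis +
  fixes N :: "'a set"
  assumes nilradical: "is_nilradical N"
    and dim_N: "dim N = 2"
    and dim_whole: "dim (UNIV :: 'a set) = 4"
begin

lemma ideal_N: "two_sided_ideal N" and nilpotent_N: "nilpotent N"
  using nilradical by (auto simp: is_nilradical_def)

lemma subspace_N: "subspace N"
  using ideal_N by (simp add: two_sided_ideal_def)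

lemma bracket_in_N: "bracket a b \<in> N"
  by (rule bracket_in_nilradical[OF nilradical])

text \<open>The span has dimension at most 3. Choosing first a vector outside \<open>N\<close> and
  then applying this with \<open>c\<close> equal to it gives two vectors independent modulo
  \<open>N\<close>.\<close>

lemma outside_nilradical:
  obtains a where "a \<notin> span (insert c N)"
proof -
  have "dim (span (insert c N)) \<noteq> dim (UNIV :: 'a set)"
    using dim_whole dim_N by (simp only: dim_span dim_insert) simp
  then show thesis using that by (metis UNIV_eq_I)
qed

text \<open>All brackets lie in \<open>N\<close>, so \<open>N\<close> together with \<open>a\<close>
  spans an ideal \<open>I\<close>. Right multiplication by \<open>I\<close> moves each member of the
  chain \<open>I\<close>, \<open>N\<close>, \<open>W\<close>, \<open>0\<close> into the next, so
  \<open>I\<close> is nilpotent, against the maximality of \<open>N\<close>.\<close>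

lemma nilradical_not_extendable:
  assumes "a \<notin> N" and "subspace W" and "W \<subseteq> N"
    and NN: "\<And>m n. m \<in> N \<Longrightarrow> n \<in> N \<Longrightarrow> bracket m n \<in> W"
    and Na: "\<And>m. m \<in> N \<Longrightarrow> bracket m a \<in> W"
    and WN: "\<And>v n. v \<in> W \<Longrightarrow> n \<in> N \<Longrightarrow> bracket v n = 0"
    and Wa: "\<And>v. v \<in> W \<Longrightarrow> bracket v a = 0"
  shows False
proof -
  define I where "I = span (insert a N)"
  have N_I: "N \<subseteq> I" and a_I: "a \<in> I"
    unfolding I_def using span_superset by (fast, simp add: span_base)
  have ideal_I: "two_sided_ideal I"
    unfolding two_sided_ideal_def using N_I bracket_in_N by (auto simp: I_def subspace_span)
  have bound: "bracket p q \<in> V"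
    if "q \<in> I" "subspace V" "bracket p a \<in> V" "\<And>n. n \<in> N \<Longrightarrow> bracket p n \<in> V" for p q V
  proof -
    have "I \<subseteq> {q. bracket p q \<in> V}"
      unfolding I_def using that by (intro span_minimal subspace_left_preimage) auto
    with \<open>q \<in> I\<close> show ?thesis by auto
  qed
  let ?S = "lower_central_series I"
  have 1: "?S 1 \<subseteq> N"
    using bracket_span_subset[OF subspace_N, of I I] bracket_in_N by simp
  have 2: "bracket_span N I \<subseteq> W"
    using bound NN Na \<open>subspace W\<close> by (intro bracket_span_subset) auto
  have 3: "bracket_span W I \<subseteq> {0}"
    using bound[OF _ subspace_zero] WN Wa by (intro bracket_span_subset subspace_zero) auto
  have "?S 2 \<subseteq> W"
    using bracket_span_mono[OF 1 subset_refl] 2 by (simp add: numeral_2_eq_2) blast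
  then have "?S 3 \<subseteq> {0}"
    using bracket_span_mono[OF _ subset_refl] 3 by (simp add: numeral_3_eq_3 numeral_2_eq_2) blast
  moreover have "0 \<in> ?S 3"
    using lower_central_series_subspace[of I 3] subspace_0 by (simp add: I_def)
  ultimately have "nilpotent I" unfolding nilpotent_def by blast
  with ideal_I N_I nilradical have "I = N" unfolding is_nilradical_def by blast
  with a_I \<open>a \<notin> N\<close> show False by simp
qed

text \<open>If \<open>[N,N] \<noteq> 0\<close>, then \<open>N/[N,N]\<close> is a line and some \<open>a \<notin> N\<close> acts on it by zero. Being a
  derivation, \<open>a\<close> then also kills \<open>[N,N]\<close>.\<close>

lemma nilradical_abelian:
  assumes "m \<in> N" "n \<in> N"
  shows "bracket m n = 0"
proof (rule ccontr)
  assume nz: "bracket m n \<noteq> 0"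
  define W where "W = bracket_span N N"
  have W: "lower_central_series N 1 = W" by (simp add: W_def)
  have WN: "lower_central_series N 2 = bracket_span W N" by (simp add: W_def numeral_2_eq_2)
  have subspace_W: "subspace W" by (simp add: W_def subspace_bracket_span)
  \<comment> \<open>The series drops strictly from \<open>N\<close> to \<open>W\<close> and from
    \<open>W\<close> to \<open>[W,N]\<close>. Starting in dimension 2, this leaves dimension 0 for
    \<open>[W,N]\<close>.\<close>
  have "N \<noteq> {0}"
    using dim_N dim_eq_0[of N] by fastforce
  then have W_N: "W \<subset> N"
    using lower_central_series_strict[OF nilpotent_N ideal_N, of 0]
      lower_central_series_decreasing[OF ideal_N, of 0] by (auto simp: W_def)
  have W_nz: "W \<noteq> {0}" using nz assms bracket_span_memI unfolding W_def by blast
  have dim_W: "dim W < 2"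
    using W_N subspace_W subspace_N dim_N by (metis dim_psubset span_eq_iff)
  have sub: "subspace (bracket_span W N)" by (rule subspace_bracket_span)
  have le: "bracket_span W N \<subset> W"
    using lower_central_series_strict[OF nilpotent_N ideal_N, of 1] W_nz
      lower_central_series_decreasing[OF ideal_N, of 1] by (auto simp: W_def)
  then have "dim (bracket_span W N) < dim W"
    using subspace_W sub by (metis dim_psubset span_eq_iff)
  then have "dim (bracket_span W N) = 0" using dim_W by linarith
  then have WN0: "bracket v k = 0" if "v \<in> W" "k \<in> N" for v k
    using bracket_span_memI[OF that] by auto
  have NW0: "bracket k v = 0" if "v \<in> W" "k \<in> N" for v k
  proof -
    \<comment> \<open>The Leibniz identity writes this as a difference of two elements of
      \<open>[W,N]\<close>.\<close>
    have "bracket k (bracket p q) = 0" if "p \<in> N" "q \<in> N" for p q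
      using WN0 that \<open>k \<in> N\<close> by (simp add: leibniz W_def bracket_span_memI)
    then have "W \<subseteq> {v. bracket k v \<in> {0}}"
      unfolding W_def by (intro bracket_span_subset subspace_left_preimage subspace_zero) auto
    with \<open>v \<in> W\<close> show ?thesis by auto
  qed
  have W_right: "bracket v l \<in> W" if "v \<in> W" for v l
    using lower_central_series_right_ideal[OF ideal_N, of v 1 l] that W by simp
  obtain g where g: "g \<in> N" "g \<notin> W" using W_N by blast
  have "dim W \<noteq> 0" using W_nz subspace_W subspace_0 dim_eq_0[of W] by auto
  moreover have "g \<notin> span W" using g subspace_W span_eq_iff by blast
  ultimately have "dim (insert g W) \<ge> 2"
    by (simp add: dim_insert del: dim_eq_0)
  then have "span (insert g W) = N"
    using g W_N dim_N subspace_N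
    by (intro subspace_dim_equal) (auto simp: span_minimal)
  then have N_split: "\<exists>k. v - scale k g \<in> W" if "v \<in> N" for v
    using that span_breakdown_eq[of v g W] span_eq_iff[THEN iffD2, OF subspace_W] by simp
  obtain c where c: "c \<notin> N" "bracket g c \<in> W"
  proof -
    obtain a where a: "a \<notin> N"
      using outside_nilradical[of 0] span_superset[of "insert 0 N"] by auto
    obtain b where b: "b \<notin> span (insert a N)" using outside_nilradical by blast
    obtain \<alpha> where \<alpha>: "bracket g a - scale \<alpha> g \<in> W" using N_split bracket_in_N by blast
    obtain \<beta> where \<beta>: "bracket g b - scale \<beta> g \<in> W" using N_split bracket_in_N by blast
    show thesis
    proof (cases "\<alpha> = 0")
      case True
      with \<alpha> a that show thesis by simp
    next
      case False
      \<comment> \<open>Modulo \<open>W\<close>, the elements \<open>a\<close> and \<open>b\<close>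
        multiply \<open>g\<close> by \<open>\<alpha>\<close> and \<open>\<beta>\<close>; this
        combination multiplies it by 0.\<close>
      define c where "c = b - scale (\<beta> / \<alpha>) a"
      have "bracket g c = (bracket g b - scale \<beta> g) - scale (\<beta> / \<alpha>) (bracket g a - scale \<alpha> g)"
        using False by (simp add: c_def bracket_linear scale_right_diff_distrib)
      then have "bracket g c \<in> W" using \<alpha> \<beta> subspace_W by (simp add: subspace_diff subspace_scale)
      moreover have "c \<notin> N"
        using b span_base[of c N] by (auto simp: span_breakdown_eq c_def)
      ultimately show thesis using that by blast
    qed
  qed
  have Nc: "bracket v c \<in> W" if v: "v \<in> N" for v
  proof -
    obtain k where "v - scale k g \<in> W" using N_split v by blast
    then have "bracket (v - scale k g) c + scale k (bracket g c) \<in> W"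
      using W_right c(2) subspace_W by (simp add: subspace_add subspace_scale)
    then show ?thesis by (simp add: bracket_linear)
  qed
  have Wc: "bracket v c = 0" if "v \<in> W" for v
  proof -
    have "bracket (bracket p q) c = 0" if "p \<in> N" "q \<in> N" for p q
      using NW0[OF Nc] WN0[OF Nc] that by (simp add: right_derivation[of p q c])
    then have "W \<subseteq> {v. bracket v c \<in> {0}}"
      unfolding W_def by (intro bracket_span_subset subspace_right_preimage subspace_zero) auto
    with \<open>v \<in> W\<close> show ?thesis by auto
  qed
  show False
    by (rule nilradical_not_extendable[OF c(1) subspace_W _ _ Nc])
      (use W_N WN0 Wc in \<open>auto simp: W_def bracket_span_memI\<close>)
qed

section \<open>The diagonal action on the nilradical\<close>

lemma right_commute: "n \<in> N \<Longrightarrow> bracket (bracket n a) b = bracket (bracket n b) a"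
  using leibniz[of n a b] nilradical_abelian[OF _ bracket_in_N] by simp

text \<open>The trace of right multiplication on \<open>N\<close> is a linear functional, and two
  directions independent modulo \<open>N\<close> admit a combination outside \<open>N\<close> on
  which it vanishes.\<close>

lemma trace_zero_direction:
  assumes basis: "N = span {e, f}"
  obtains c p q r where "c \<notin> N"
    "bracket e c = scale p e + scale r f" "bracket f c = scale q e + scale (- p) f"
proof -
  obtain a where a: "a \<notin> N"
    using outside_nilradical[of 0] span_superset[of "insert 0 N"] by auto
  obtain b where b: "b \<notin> span (insert a N)" using outside_nilradical by blast
  have coords: "\<exists>\<alpha> \<beta>. bracket u v = scale \<alpha> e + scale \<beta> f" for u v
    using bracket_in_N basis span_pair_iff by blast
  obtain p r where a_e: "bracket e a = scale p e + scale r f" using coords by blast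
  obtain q s where a_f: "bracket f a = scale q e + scale s f" using coords by blast
  obtain p' r' where b_e: "bracket e b = scale p' e + scale r' f" using coords by blast
  obtain q' s' where b_f: "bracket f b = scale q' e + scale s' f" using coords by blast
  show thesis
  proof (cases "p + s = 0")
    case True
    then have "s = - p" by (simp add: eq_neg_iff_add_eq_0 add.commute)
    with a a_e a_f that show thesis by blast
  next
    case False
    define k where "k = (p' + s') / (p + s)"
    have trace: "s' - k * s = - (p' - k * p)"
      using False by (simp add: k_def field_simps)
    show thesis
    proof (rule that[of "b - scale k a"])
      show "b - scale k a \<notin> N"
        using b span_base by (auto simp: span_breakdown_eq)
      show "bracket e (b - scale k a) = scale (p' - k * p) e + scale (r' - k * r) f"
        by (simp add: a_e b_e bracket_linear algebra_simps)
      show "bracket f (b - scale k a) = scale (q' - k * q) e + scale (- (p' - k * p)) f"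
        unfolding trace[symmetric] by (simp add: a_f b_f bracket_linear algebra_simps)
    qed
  qed
qed

text \<open>If \<open>c\<close> squared to zero on \<open>N\<close>, its kernel in \<open>N\<close>
  would serve as the subspace \<open>W\<close> of \<open>nilradical_not_extendable\<close>.\<close>

lemma right_square_scalar_nonzero:
  assumes "c \<notin> N" and sq: "\<And>n. n \<in> N \<Longrightarrow> bracket (bracket n c) c = scale \<delta> n"
  shows "\<delta> \<noteq> 0"
proof
  assume "\<delta> = 0"
  define W where "W = N \<inter> {n. bracket n c \<in> {0}}"
  have "subspace W"
    unfolding W_def by (intro subspace_inter subspace_N subspace_right_preimage subspace_zero)
  then show False
    by (rule nilradical_not_extendable[OF assms(1)])
      (use sq \<open>\<delta> = 0\<close> nilradical_abelian bracket_in_N subspace_0[OF subspace_N] in \<open>auto simp: W_def\<close>)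
qed

lemma right_involution:
  obtains c x y where "c \<notin> N" "x \<noteq> 0" "y \<noteq> 0" "x \<in> N" "y \<in> N"
    "bracket x c = x" "bracket y c = - y"
proof -
  obtain B where B: "B \<subseteq> N" "independent B" "N \<subseteq> span B" "card B = dim N"
    by (rule basis_exists)
  then obtain e f where ef: "B = {e, f}" "e \<noteq> f" using dim_N by (auto simp: card_2_iff)
  have N_span: "N = span {e, f}"
    using B ef span_minimal[OF _ subspace_N] by blast
  have ef_ind: "e \<notin> span {f}" "f \<noteq> 0"
    using B(2) ef by (auto simp: independent_insert dependent_zero)
  obtain c p q r where c: "c \<notin> N"
    "bracket e c = scale p e + scale r f" "bracket f c = scale q e + scale (- p) f"
    using trace_zero_direction[OF N_span] .
  \<comment> \<open>Minus the determinant: by Cayley-Hamilton a traceless 2 by 2 matrix squares to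
    this scalar. Dividing by its square root makes the action an involution.\<close>
  define \<delta> where "\<delta> = p * p + q * r"
  have sq: "bracket (bracket n c) c = scale \<delta> n" if n: "n \<in> N" for n
  proof -
    obtain \<alpha> \<beta> where "n = scale \<alpha> e + scale \<beta> f" using n N_span span_pair_iff by blast
    then show ?thesis by (simp add: c bracket_linear \<delta>_def algebra_simps)
  qed
  define k where "k = csqrt \<delta>"
  have k: "k \<noteq> 0" "k * k = \<delta>"
    using right_square_scalar_nonzero[OF c(1) sq] by (simp_all add: k_def flip: power2_eq_square)
  define c' where "c' = scale (1 / k) c"
  have c'_N: "c' \<notin> N"
  proof
    assume "c' \<in> N"
    then have "scale k c' \<in> N" using subspace_N by (rule subspace_scale[rotated])
    with c(1) k show False by (simp add: c'_def)
  qed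
  have sq': "bracket (bracket n c') c' = n" if "n \<in> N" for n
    using sq[OF that] k(1) by (simp add: c'_def bracket_linear flip: k(2))
  \<comment> \<open>A scalar matrix of trace zero is zero. So \<open>c'\<close> acts neither as 1
    nor as -1, and both eigenvalues occur.\<close>
  have no_scalar: "\<epsilon> = 0" if "\<And>n. n \<in> N \<Longrightarrow> bracket n c' = scale \<epsilon> n" for \<epsilon>
  proof -
    have eN: "e \<in> N" "f \<in> N" using B(1) ef by auto
    have kc: "bracket n c = scale (k * \<epsilon>) n" if "n \<in> N" for n
    proof -
      have "bracket n c = scale k (bracket n c')" using k by (simp add: c'_def bracket_linear)
      then show ?thesis using \<open>\<And>n. n \<in> N \<Longrightarrow> bracket n c' = scale \<epsilon> n\<close>[OF that] by simp
    qed
    have "scale r f + scale (p - k * \<epsilon>) e = 0" "scale (- p - k * \<epsilon>) f + scale q e = 0"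
      using kc[OF eN(1)] kc[OF eN(2)] c by (simp_all add: algebra_simps)
    then have "p - k * \<epsilon> = 0" "- p - k * \<epsilon> = 0"
      using independent_pair_zeroD[OF ef_ind(2,1)] by blast+
    then show ?thesis using k by simp
  qed
  obtain m where m: "m \<in> N" "m + bracket m c' \<noteq> 0"
    using no_scalar[of "- 1"] by (auto simp: eq_neg_iff_add_eq_0 add.commute)
  obtain n where n: "n \<in> N" "n - bracket n c' \<noteq> 0"
    using no_scalar[of 1] by (metis eq_iff_diff_eq_0 scale_one zero_neq_one)
  \<comment> \<open>Since \<open>c'\<close> squares to the identity on \<open>N\<close>, adding or
    subtracting the image projects, up to a factor 2, onto the eigenspaces of 1 and -1.\<close>
  show thesis
    by (rule that[of c' "m + bracket m c'" "n - bracket n c'"])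
      (use m n c'_N bracket_in_N subspace_N in
        \<open>auto simp: bracket_linear sq' subspace_add subspace_diff\<close>)
qed

lemma scale_two: "scale 2 v = v + v"
  using scale_left_distrib[of 1 1 v] by simp

lemma weight_basis:
  obtains x y z w where "x \<noteq> 0" "y \<noteq> 0" "x \<in> N" "y \<in> N" "N \<subseteq> span {x, y}"
    "bracket x z = x" "bracket y z = 0" "bracket x w = 0" "bracket y w = y"
proof -
  obtain c x y where c: "c \<notin> N" "x \<noteq> 0" "y \<noteq> 0" "x \<in> N" "y \<in> N"
    "bracket x c = x" "bracket y c = - y" using right_involution .
  have self_neg: "v = 0" if "v = - v" for v :: 'a
    using that scale_two[of v] scale_eq_0_iff[of 2 v] by (simp add: eq_neg_iff_add_eq_0)
  have y_x: "y \<notin> span {x}"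
  proof
    assume "y \<in> span {x}"
    then obtain k where "y = scale k x" by (auto simp: span_singleton)
    then show False using c self_neg[of y] by (simp add: bracket_linear)
  qed
  have "independent {x, y}"
    using independent_insertI[OF y_x] c(2) by (simp add: insert_commute)
  moreover have "x \<noteq> y" using y_x by (auto intro: span_base)
  ultimately have N_span: "N \<subseteq> span {x, y}"
    using c dim_N by (intro card_ge_dim_independent) auto
  obtain d where d: "d \<notin> span (insert c N)" using outside_nilradical by blast
  obtain \<rho> \<rho>' where \<rho>: "bracket x d = scale \<rho> x + scale \<rho>' y"
    using N_span bracket_in_N span_pair_iff by blast
  obtain \<sigma>' \<sigma> where \<sigma>: "bracket y d = scale \<sigma>' x + scale \<sigma> y"
    using N_span bracket_in_N span_pair_iff by blast
  \<comment> \<open>By \<open>right_commute\<close>, \<open>d\<close> commutes with \<open>c\<close>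
    on \<open>N\<close>; as \<open>c\<close> has the distinct eigenvalues 1 and -1, the off-diagonal
    entries of \<open>d\<close> vanish.\<close>
  have "scale \<rho>' y = - scale \<rho>' y"
    using right_commute[OF c(4), of c d] c \<rho> by (simp add: bracket_linear)
  then have x_d: "bracket x d = scale \<rho> x" using self_neg \<rho> by force
  have "scale \<sigma>' x = - scale \<sigma>' x"
    using right_commute[OF c(5), of c d] c \<sigma> by (simp add: bracket_linear)
  then have y_d: "bracket y d = scale \<sigma> y" using self_neg \<sigma> by force
  \<comment> \<open>Subtracting the traceless part of diag(\<open>\<rho>\<close>,
    \<open>\<sigma>\<close>), a multiple of \<open>c\<close>, leaves \<open>h\<close> acting as the
    scalar \<open>\<tau>\<close>.\<close>
  define \<tau> where "\<tau> = (\<rho> + \<sigma>) / 2"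
  define h where "h = d - scale ((\<rho> - \<sigma>) / 2) c"
  have "h \<notin> N" using d span_base by (auto simp: span_breakdown_eq h_def)
  have x_h: "bracket x h = scale \<tau> x"
    by (simp add: h_def bracket_linear x_d c \<tau>_def field_simps flip: scale_left_diff_distrib)
  have "scale (\<sigma> + (\<rho> - \<sigma>) / 2) y = scale \<tau> y"
    by (simp add: \<tau>_def field_simps)
  then have y_h: "bracket y h = scale \<tau> y"
    by (simp add: h_def bracket_linear y_d c scale_left_distrib)
  have N_h: "bracket n h = scale \<tau> n" if n: "n \<in> N" for n
  proof -
    obtain \<alpha> \<beta> where "n = scale \<alpha> x + scale \<beta> y" using n N_span span_pair_iff by blast
    then show ?thesis by (simp add: bracket_linear x_h y_h scale_right_distrib mult.commute)
  qed
  have "\<tau> * \<tau> \<noteq> 0"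
    by (rule right_square_scalar_nonzero[OF \<open>h \<notin> N\<close>]) (simp add: N_h bracket_linear)
  then have \<tau>: "\<tau> \<noteq> 0" by simp
  have half: "scale (1 / 2) (v + v) = v" for v
    by (simp flip: scale_two)
  define i where "i = scale (1 / \<tau>) h"
  have i: "bracket x i = x" "bracket y i = y"
    using \<tau> by (simp_all add: i_def bracket_scale_right x_h y_h)
  \<comment> \<open>With \<open>i\<close> acting as the identity and \<open>c\<close> as diag(1,
    -1), the halves of \<open>i + c\<close> and \<open>i - c\<close> act as the two diagonal
    idempotents.\<close>
  show thesis
  proof (rule that[OF c(2-5) N_span])
    show "bracket x (scale (1 / 2) (i + c)) = x" "bracket y (scale (1 / 2) (i + c)) = 0"
      "bracket x (scale (1 / 2) (i - c)) = 0" "bracket y (scale (1 / 2) (i - c)) = y"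
      by (simp_all only: bracket_linear i c diff_minus_eq_add half) simp_all
  qed
qed

section \<open>Normalized basis and isomorphism with the model algebra\<close>

lemma R1_basis_exists:
  obtains x y z w where "x \<noteq> 0" "y \<noteq> 0" "\<forall>u. bracket u x = 0" "\<forall>u. bracket u y = 0"
    "bracket x z = x" "bracket y z = 0" "bracket z z = 0" "bracket w z = 0"
    "bracket x w = 0" "bracket y w = y" "bracket z w = 0" "bracket w w = 0"
proof -
  obtain x y z w where b: "x \<noteq> 0" "y \<noteq> 0" "x \<in> N" "y \<in> N" "N \<subseteq> span {x, y}"
    "bracket x z = x" "bracket y z = 0" "bracket x w = 0" "bracket y w = y"
    using weight_basis .
  \<comment> \<open>Here \<open>[u,x] = [u,[x,z]] = [x,[z,u]]\<close> by rotation, a product of two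
    elements of the abelian \<open>N\<close>.\<close>
  have "bracket u x = 0" for u
    using triple_rotate[of x z u] nilradical_abelian[OF b(3) bracket_in_N] b by simp
  moreover have "bracket u y = 0" for u
    using triple_rotate[of y w u] nilradical_abelian[OF b(4) bracket_in_N] b by simp
  ultimately have right_zero: "bracket u n = 0" if "n \<in> N" for u n
    using that b(5) span_pair_iff[of n x y] by (auto simp: bracket_linear)
  have correction: "\<exists>v\<in>N. bracket (u - v) z = 0 \<and> bracket (u - v) w = 0" for u
  proof -
    obtain \<alpha> \<beta> where uz: "bracket u z = scale \<alpha> x + scale \<beta> y"
      using b(5) bracket_in_N span_pair_iff by blast
    obtain \<gamma> \<delta> where uw: "bracket u w = scale \<gamma> x + scale \<delta> y"
      using b(5) bracket_in_N span_pair_iff by blast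
    \<comment> \<open>As \<open>[u,[z,w]] = 0\<close>, the two orders agree. They lie on the lines
      of \<open>y\<close> and \<open>x\<close>, so both vanish, and an element of \<open>N\<close>
      can absorb what remains of \<open>[u,z]\<close> and \<open>[u,w]\<close>.\<close>
    have "bracket (bracket u z) w = bracket (bracket u w) z"
      using leibniz[of u z w] right_zero[OF bracket_in_N] by simp
    then have eq: "scale \<beta> y = scale \<gamma> x"
      by (simp add: uz uw bracket_linear b)
    then have "bracket (scale \<beta> y) z = bracket (scale \<gamma> x) z" by simp
    then have "scale \<gamma> x = 0" by (simp add: bracket_linear b)
    then have uz: "bracket u z = scale \<alpha> x" and uw: "bracket u w = scale \<delta> y"
      using eq uz uw by simp_all
    show ?thesis
      by (rule bexI[of _ "scale \<alpha> x + scale \<delta> y"])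
        (use b subspace_N in \<open>simp_all add: bracket_linear uz uw subspace_add subspace_scale\<close>)
  qed
  obtain v where v: "v \<in> N" "bracket (z - v) z = 0" "bracket (z - v) w = 0"
    using correction by blast
  obtain v' where v': "v' \<in> N" "bracket (w - v') z = 0" "bracket (w - v') w = 0"
    using correction by blast
  \<comment> \<open>Because \<open>[u,N] = 0\<close>, correcting \<open>z\<close> and
    \<open>w\<close> by elements of \<open>N\<close> leaves their right multiplications
    unchanged.\<close>
  have shift: "bracket u (z - v) = bracket u z" "bracket u (w - v') = bracket u w" for u
    using right_zero v v' by (simp_all add: bracket_diff_right)
  show thesis
    by (rule that[of x y "z - v" "w - v'"]) (simp_all add: shift b v v' right_zero)
qed

lemma R1_isomorphic: "leibniz_isomorphic scale bracket (*s) R1_bracket"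
proof -
  obtain x y z w where b: "x \<noteq> 0" "y \<noteq> 0" "\<forall>u. bracket u x = 0" "\<forall>u. bracket u y = 0"
    "bracket x z = x" "bracket y z = 0" "bracket z z = 0" "bracket w z = 0"
    "bracket x w = 0" "bracket y w = y" "bracket z w = 0" "bracket w w = 0"
    by (rule R1_basis_exists)
  define g where
    "g v = scale (v $ 1) x + scale (v $ 2) y + scale (v $ 3) z + scale (v $ 4) w" for v :: "complex ^ 4"
  have add: "g (u + v) = g u + g v" and scale: "g (k *s v) = scale k (g v)" for u v k
    by (simp_all add: g_def algebra_simps)
  have diff: "g (u - v) = g u - g v" for u v
    by (simp add: g_def algebra_simps)
  have brk: "g (R1_bracket u v) = bracket (g u) (g v)" for u v
    by (simp add: g_def R1_bracket_coordinates bracket_linear b mult.commute)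
  \<comment> \<open>Brackets with the basis vectors read off all four coordinates, which gives
    linear independence.\<close>
  have kernel: "v = 0" if v: "g v = 0" for v
  proof -
    have "bracket x (g v) = scale (v $ 3) x" "bracket y (g v) = scale (v $ 4) y"
      "bracket (g v) z = scale (v $ 1) x" "bracket (g v) w = scale (v $ 2) y"
      by (simp_all add: g_def bracket_linear b)
    with v b show ?thesis by (simp add: vec_eq_iff forall_4)
  qed
  have "inj g" by (rule injI) (metis kernel diff eq_iff_diff_eq_0)
  interpret pair: finite_dimensional_vector_space_pair "(*s)" "cart_basis :: (complex ^ 4) set" scale Basis
    by unfold_locales
  have "dim (UNIV :: 'a set) = vec.dim (UNIV :: (complex ^ 4) set)"
    by (simp only: dim_whole vec.dim_UNIV card_cart_basis) simp
  then have "surj g"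
    using \<open>inj g\<close> add scale
    by (intro pair.linear_injective_imp_surjective)
      (simp_all add: Vector_Spaces.linear_iff vector_space_axioms vec.vector_space_axioms)
  define f where "f = inv g"
  have fg: "f (g v) = v" and gf: "g (f a) = a" for v a
    using \<open>inj g\<close> \<open>surj g\<close> by (simp_all add: f_def surj_f_inv_f)
  have "Vector_Spaces.linear scale (*s) f"
    unfolding Vector_Spaces.linear_iff
    by (intro conjI allI vector_space_axioms vec.vector_space_axioms)
      (metis add scale fg gf)+
  moreover have "bij f" unfolding f_def using \<open>inj g\<close> \<open>surj g\<close> by (intro bij_imp_bij_inv bijI)
  moreover have "f (bracket a a') = R1_bracket (f a) (f a')" for a a'
    by (metis brk fg gf)
  ultimately show ?thesis unfolding leibniz_isomorphic_def by blast
qed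

end

theorem theorem5p4:
  fixes scale :: "complex \<Rightarrow> 'a::ab_group_add \<Rightarrow> 'a"
    and bracket :: "'a \<Rightarrow> 'a \<Rightarrow> 'a"
    and N :: "'a set"
  assumes "right_leibniz_algebra scale bracket"
    and "vector_space.dim scale (UNIV :: 'a set) = 4"
    and "right_leibniz_algebra.solvable scale bracket"
    and "right_leibniz_algebra.is_nilradical scale bracket N"
    and "vector_space.dim scale N = 2"
  shows "right_leibniz_algebra.dextral_symmetric bracket \<longleftrightarrow>
         leibniz_isomorphic scale bracket (*s) R1_bracket"
proof
  interpret L: right_leibniz_algebra scale bracket by fact
  assume dextral: "L.dextral_symmetric"
  obtain B where B: "L.independent B" "UNIV \<subseteq> L.span B" "card B = L.dim (UNIV :: 'a set)"
    by (rule L.basis_exists)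
  \<comment> \<open>An infinite set has \<open>card\<close> 0, not 4.\<close>
  have "finite B"
    using B(3) assms(2) card_ge_0_finite[of B] by simp
  interpret L: dextral_symmetric_nilradical_plane scale bracket B N
    by unfold_locales (use dextral B \<open>finite B\<close> assms in auto)
  show "leibniz_isomorphic scale bracket (*s) R1_bracket"
    by (rule L.R1_isomorphic)
next
  interpret L: right_leibniz_algebra scale bracket by fact
  interpret R1: right_leibniz_algebra "(*s)" R1_bracket by (rule right_leibniz_algebra_R1)
  assume "leibniz_isomorphic scale bracket (*s) R1_bracket"
  then obtain f where f: "Vector_Spaces.linear scale (*s) f" "bij f"
    and f_bracket: "f (bracket a b) = R1_bracket (f a) (f b)" for a b
    unfolding leibniz_isomorphic_def by blast
  have "f 0 = 0"
    using f(1) by (metis Vector_Spaces.linear_iff add_cancel_left_left)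
  \<comment> \<open>Every bracket in the model has third and fourth coordinates 0, and only these
    coordinates of a right factor matter.\<close>
  moreover have "f (bracket a (bracket b c)) = 0" for a b c
    by (simp add: f_bracket vec_eq_iff forall_4 R1_bracket_coordinates)
  ultimately have "bracket a (bracket b c) = 0" for a b c
    using bij_is_inj[OF f(2)] by (metis injD)
  then show "L.dextral_symmetric"
    by (simp add: L.dextral_symmetric_def)
qed

end
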